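(* Let $x\in[0,1]$. Then $$\sum_{n=0}^{\infty}E_n(x;\alpha)\,t^n=e^{xt}.$$
   Context: Here $\alpha$ is a continuous parameter and $t$ is the generating variable. The functions $N_{0,n}$, $n\in\{0,1,2,\dots\}$, are the uniform B-splines (integer knots), which satisfy the de Boor recurrence $$N_{0,n}(x)=\frac{x}{n}N_{0,n-1}(x)+\frac{n+1-x}{n}N_{1,n-1}(x),\qquad n\ge1,$$ where $N_{1,n}$ is the translate of $N_{0,n}$ by $1$, that is $N_{1,n}(x)=N_{0,n}(x-1)$, and the convention is that $N_{1,n}(x)=0$ for $x\le 1$. On the interval $[0,1]$ one has $N_{0,0}(x)=1$ and, in general, $N_{0,n}(x)=\frac{x^n}{n!}$ for $0\le x\le 1$. The support convention is that for $x\in[0,1]$ one has $N_{0,n}(x-k)=0$ for all integers $k\ge1$. The exponential B-spline of order $n$ is defined by $$E_n(x;\alpha)=\sum_{k=0}^{\infty}e^{-\alpha k}N_{0,n}(x-k).$$ *)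

theory Defs
  imports Complex_Main "HOL-Library.Indicator_Function"
begin

text \<open>
  Translate by \<open>k\<close> of a function supported on \<open>x \<ge> 0\<close>, with the convention that for
  \<open>k \<ge> 1\<close> it vanishes at and to the left of its first knot \<open>k\<close>. For the B-splines below
  this differs from \<open>f (x - k)\<close> only when the degree is \<open>0\<close> and \<open>x = k\<close>
  (see \<open>translate_bspline_Suc\<close> and \<open>translate_bspline_0\<close>): the pieces of degree \<open>0\<close> live on
  \<open>[0,1]\<close>, \<open>(1,2]\<close>, \<open>(2,3]\<close>, and so on, so that exactly one of them equals \<open>1\<close> at each
  \<open>x \<ge> 0\<close>, the endpoints included.
\<close>

definition translate :: "nat \<Rightarrow> (real \<Rightarrow> real) \<Rightarrow> real \<Rightarrow> real" where
  "translate k f x = (if k \<ge> 1 \<and> x \<le> real k then 0 else f (x - real k))"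

text \<open>\<open>bspline n\<close> is \<open>N\<^sub>0\<^sub>,\<^sub>n\<close>, and \<open>translate k (bspline n)\<close> is \<open>N\<^sub>k\<^sub>,\<^sub>n\<close>.\<close>

primrec bspline :: "nat \<Rightarrow> real \<Rightarrow> real" where
  "bspline 0 = indicator {0..1}"
| "bspline (Suc n) = (\<lambda>x. x / real (Suc n) * bspline n x
     + (real (Suc n) + 1 - x) / real (Suc n) * translate 1 (bspline n) x)"

definition exp_bspline :: "nat \<Rightarrow> real \<Rightarrow> 'a::{real_normed_field, banach} \<Rightarrow> 'a" where
  "exp_bspline n x \<alpha> = (\<Sum>k. exp (- \<alpha> * of_nat k) * of_real (translate k (bspline n) x))"

lemma bspline_nonpos: "x < 0 \<or> n \<ge> 1 \<and> x = 0 \<Longrightarrow> bspline n x = 0"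
proof (induction n)
  case 0
  then show ?case by auto
next
  case (Suc n)
  have "x * bspline n x = 0"
    using Suc by (cases "x = 0") auto
  then show ?case
    using Suc.prems by (auto simp: translate_def)
qed

lemma translate_bspline_Suc: "translate k (bspline (Suc n)) x = bspline (Suc n) (x - real k)"
  using bspline_nonpos[of "x - real k" "Suc n"]
  by (auto simp: translate_def le_less simp del: bspline.simps)

lemma translate_bspline_0:
  "translate k (bspline 0) x = (if k \<ge> 1 \<and> x = real k then 0 else bspline 0 (x - real k))"
  by (auto simp: translate_def)

lemma summable_exp_bspline:
  fixes \<alpha> :: "'a::{real_normed_field, banach}"
  shows "summable (\<lambda>k. exp (- \<alpha> * of_nat k) * of_real (translate k (bspline n) x))"
proof (rule summable_finite)
  show "finite {k. real k \<le> \<bar>x\<bar>}"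
    by (rule finite_subset[of _ "{..nat \<lfloor>\<bar>x\<bar>\<rfloor>}"]) (auto simp: le_nat_floor)
  show "exp (- \<alpha> * of_nat k) * of_real (translate k (bspline n) x) = 0"
    if "k \<notin> {k. real k \<le> \<bar>x\<bar>}" for k
    using that by (auto simp: translate_def bspline_nonpos)
qed

end

theory Submission
  imports Defs
begin

text \<open>On [0,1] all translates by k >= 1 vanish. The recurrence thus loses its second summand
  and yields x^n / n!, while the series over k keeps only k = 0, whose weight exp 0 = 1 does not
  involve \<alpha>. The generating function is then the exponential series at x t.\<close>

lemma translate_left_zero:
  assumes "k \<ge> 1" and "x \<le> 1"
  shows "translate k f x = 0"
  using assms by (auto simp: translate_def)

lemma bspline_unit_interval:
  assumes "x \<in> {0..1}"
  shows "bspline n x = x ^ n / fact n"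
  using assms by (induction n) (simp_all add: translate_left_zero mult.commute)

lemma exp_bspline_unit_interval:
  fixes \<alpha> :: "'a::{real_normed_field, banach}"
  assumes "x \<in> {0..1}"
  shows "exp_bspline n x \<alpha> = of_real (x ^ n / fact n)"
proof -
  have "exp_bspline n x \<alpha>
      = (\<Sum>k\<in>{0}. exp (- \<alpha> * of_nat k) * of_real (translate k (bspline n) x))"
    unfolding exp_bspline_def
    \<comment> \<open>At x = 1 and degree 0 the term k = 1 is zero only because
      \<open>translate\<close> vanishes at the knot itself; \<open>bspline 0 0\<close> is 1.\<close>
    using assms by (intro suminf_finite) (auto simp: translate_left_zero)
  then show ?thesis
    using bspline_unit_interval[OF assms] by (simp add: translate_def)
qed

theorem theorem8:
  fixes \<alpha> t :: "'a::{real_normed_field, banach}" and x :: real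
  assumes "x \<in> {0..1}"
  shows "(\<lambda>n. exp_bspline n x \<alpha> * t ^ n) sums exp (of_real x * t)"
proof -
  \<comment> \<open>The scaling by \<open>/\<^sub>R\<close> matches the terms in
    \<open>exp_converges\<close>.\<close>
  have "exp_bspline n x \<alpha> * t ^ n = (of_real x * t) ^ n /\<^sub>R fact n" for n
    using assms
    by (simp add: exp_bspline_unit_interval scaleR_conv_of_real power_mult_distrib field_simps)
  then show ?thesis
    using exp_converges[of "of_real x * t"] by simp
qed

end
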